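(* Let $n\in\mathbb N$ and let $D$ be a digraph on $n$ vertices. For $k\geq 3$ let $\overrightarrow{TC}_k$ denote the transitive cycle on $k$ vertices. If $D$ is $\overrightarrow{TC}_k$-free for all $k\geq 3$, then $$e(D)\leq \max\left\{2(n-1),\ \left\lfloor \frac{n^2}{4}\right\rfloor\right\}.$$
   Context: $\mathbb N=\{1,2,\dots\}$. Digraphs have no loops and no repeated edges, but for distinct vertices $x,y$ both directed edges $x\to y$ and $y\to x$ may be present; $e(D)$ is the number of directed edges of $D$. For $k\geq 3$, the transitive cycle on $k$ vertices $\overrightarrow{TC}_k$ is the digraph with vertex set $\{1,\dots,k\}$ whose edges are the directed edges $i\to i+1$ for $1\leq i\leq k-1$ together with the directed edge $1\to k$. $D$ is $\overrightarrow{TC}_k$-free if it contains no (not necessarily induced) subdigraph isomorphic to $\overrightarrow{TC}_k$, i.e. there are no distinct vertices $v_1,\dots,v_k$ of $D$ with $v_i\to v_{i+1}$ an edge for all $1\leq i\leq k-1$ and $v_1\to v_k$ an edge. *)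

theory Defs
  imports Complex_Main "Graph_Theory.Graph_Theory"
begin

definition transitive_cycle :: "nat \<Rightarrow> nat pair_pre_digraph" where
  "transitive_cycle k =
    \<lparr> pverts = {1..k}, parcs = {(i, i + 1) | i. 1 \<le> i \<and> i \<le> k - 1} \<union> {(1, k)} \<rparr>"

definition contains_copy :: "('a, 'b) pre_digraph \<Rightarrow> ('c, 'd) pre_digraph \<Rightarrow> bool" where
  "contains_copy D F \<longleftrightarrow> (\<exists>H. subgraph H D \<and> digraph_iso F H)"

definition TC_free :: "nat \<Rightarrow> ('a, 'b) pre_digraph \<Rightarrow> bool" where
  "TC_free k D \<longleftrightarrow> \<not> contains_copy D (with_proj (transitive_cycle k))"

lemma TC_free_iff:
  fixes D :: "('a, 'b) pre_digraph"
  assumes "wf_digraph D" and "k \<ge> 3"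
  shows "TC_free k D \<longleftrightarrow>
    \<not> (\<exists>v :: nat \<Rightarrow> 'a. inj_on v {1..k} \<and> v ` {1..k} \<subseteq> verts D \<and>
        (\<forall>i\<in>{1..k - 1}. v i \<rightarrow>\<^bsub>D\<^esub> v (i + 1)) \<and> v 1 \<rightarrow>\<^bsub>D\<^esub> v k)"
proof -
  let ?T = "with_proj (transitive_cycle k)"
  have wfT: "wf_digraph ?T"
    using assms(2) by unfold_locales (auto simp: transitive_cycle_def)
  have "contains_copy D ?T \<longleftrightarrow>
    (\<exists>v :: nat \<Rightarrow> 'a. inj_on v {1..k} \<and> v ` {1..k} \<subseteq> verts D \<and>
        (\<forall>i\<in>{1..k - 1}. v i \<rightarrow>\<^bsub>D\<^esub> v (i + 1)) \<and> v 1 \<rightarrow>\<^bsub>D\<^esub> v k)" (is "?L \<longleftrightarrow> ?R")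
  proof
    assume ?L
    then obtain f where sub: "subgraph (app_iso f ?T) D"
      and iso: "pre_digraph.digraph_isomorphism ?T f"
      unfolding contains_copy_def digraph_iso_def by blast
    let ?v = "iso_verts f"
    have edge: "?v (fst a) \<rightarrow>\<^bsub>D\<^esub> ?v (snd a)" if "a \<in> parcs (transitive_cycle k)" for a
    proof -
      have "iso_arcs f a \<in> arcs D" using sub that by (auto simp: subgraph_def)
      moreover have "tail D (iso_arcs f a) = ?v (fst a)" "head D (iso_arcs f a) = ?v (snd a)"
        using sub iso that
        by (auto simp: subgraph_def compatible_def pre_digraph.digraph_isomorphism_def)
      ultimately show ?thesis by (force simp: arcs_ends_conv)
    qed
    have "inj_on ?v {1..k}" using iso
      by (simp add: pre_digraph.digraph_isomorphism_def transitive_cycle_def)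
    moreover have "?v ` {1..k} \<subseteq> verts D" using sub
      by (simp add: subgraph_def transitive_cycle_def)
    moreover have "\<forall>i\<in>{1..k - 1}. ?v i \<rightarrow>\<^bsub>D\<^esub> ?v (i + 1)"
    proof
      fix i assume "i \<in> {1..k - 1}"
      then show "?v i \<rightarrow>\<^bsub>D\<^esub> ?v (i + 1)" using edge[of "(i, i + 1)"]
        by (simp add: transitive_cycle_def)
    qed
    moreover have "?v 1 \<rightarrow>\<^bsub>D\<^esub> ?v k" using edge[of "(1, k)"]
      by (simp add: transitive_cycle_def)
    ultimately show ?R by blast
  next
    assume ?R
    then obtain v :: "nat \<Rightarrow> 'a" where v: "inj_on v {1..k}" "v ` {1..k} \<subseteq> verts D"
        "\<forall>i\<in>{1..k - 1}. v i \<rightarrow>\<^bsub>D\<^esub> v (i + 1)" "v 1 \<rightarrow>\<^bsub>D\<^esub> v k" by blast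
    have "\<forall>a\<in>parcs (transitive_cycle k).
        \<exists>e. e \<in> arcs D \<and> tail D e = v (fst a) \<and> head D e = v (snd a)"
    proof
      fix a assume "a \<in> parcs (transitive_cycle k)"
      then have "v (fst a) \<rightarrow>\<^bsub>D\<^esub> v (snd a)" using v(3,4)
        by (auto simp: transitive_cycle_def)
      then show "\<exists>e. e \<in> arcs D \<and> tail D e = v (fst a) \<and> head D e = v (snd a)"
        by (auto simp: arcs_ends_conv)
    qed
    then obtain g where g: "\<And>a. a \<in> parcs (transitive_cycle k) \<Longrightarrow>
        g a \<in> arcs D \<and> tail D (g a) = v (fst a) \<and> head D (g a) = v (snd a)"
      by metis
    have bnd: "fst a \<in> {1..k} \<and> snd a \<in> {1..k}" if "a \<in> parcs (transitive_cycle k)" for a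
      using that assms(2) by (auto simp: transitive_cycle_def)
    have inj: "inj_on g (parcs (transitive_cycle k))"
    proof (rule inj_onI)
      fix a b assume ab: "a \<in> parcs (transitive_cycle k)" "b \<in> parcs (transitive_cycle k)"
        and "g a = g b"
      then have "v (fst a) = v (fst b)" "v (snd a) = v (snd b)" using g by metis+
      then show "a = b" using v(1) bnd[OF ab(1)] bnd[OF ab(2)]
        by (meson inj_on_eq_iff prod_eq_iff)
    qed
    let ?f = "\<lparr> iso_verts = v, iso_arcs = g, iso_head = head D, iso_tail = tail D \<rparr>"
    from inj have iso: "pre_digraph.digraph_isomorphism ?T ?f"
      using wfT v(1) g
      by (auto simp: pre_digraph.digraph_isomorphism_def transitive_cycle_def)
    have "wf_digraph (app_iso ?f ?T)"
      using g bnd assms(2) by unfold_locales (auto simp: transitive_cycle_def)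
    then have "subgraph (app_iso ?f ?T) D"
      using assms(1) v(2) g by (auto simp: subgraph_def compatible_def transitive_cycle_def)
    then show ?L using iso unfolding contains_copy_def digraph_iso_def by blast
  qed
  then show ?thesis unfolding TC_free_def by simp
qed

end

theory Submission
  imports Defs
begin

text \<open>
  In \<open>D\<close>, no arc \<open>(u, v)\<close> can be bypassed by a path avoiding that arc. Pick a root in
  each strong component. The arcs of an out-tree and an in-tree at the root already make a component
  on \<open>s\<close> vertices strongly connected, so these at most \<open>2 (s - 1)\<close> arcs are all the arcs
  inside it. Between two components there is at most one arc, and contracting every component to its
  root leaves a triangle-free graph. If there are \<open>m\<close> components, Mantel's theorem yields
  \<open>e(D) \<le> 2 (n - m) + m\<^sup>2 / 4\<close>, which is convex in \<open>m\<close>.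
\<close>

section \<open>Mantel's bound for oriented graphs\<close>

text \<open>Let \<open>v\<close> have maximum degree \<open>d\<close>. Its neighbours are pairwise
  non-adjacent, so the vertices outside \<open>N v\<close> meet every edge, each at most
  \<open>d\<close> edges; this leaves at most \<open>(card R - d) * d\<close> edges.\<close>

lemma mantel_antisym:
  assumes fin: "finite R" and sub: "H \<subseteq> R \<times> R"
    and anti: "\<And>a b. (a, b) \<in> H \<Longrightarrow> (b, a) \<notin> H"
    and tri: "\<And>a b c. (a, b) \<in> H \<union> H\<inverse> \<Longrightarrow> (b, c) \<in> H \<union> H\<inverse> \<Longrightarrow> (a, c) \<notin> H \<union> H\<inverse>"
  shows "4 * card H \<le> (card R)\<^sup>2"
proof (cases "R = {}")
  case True
  then show ?thesis using sub by simp
next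
  case False
  define N where "N x = (H \<union> H\<inverse>) `` {x}" for x
  define S where "S x = {e \<in> H. fst e = x \<or> snd e = x}" for x
  have NR: "N x \<subseteq> R" for x using sub by (auto simp: N_def)
  have finN: "finite (N x)" for x using NR fin finite_subset by blast
  have "Max ((\<lambda>x. card (N x)) ` R) \<in> (\<lambda>x. card (N x)) ` R" using fin False by simp
  then obtain v where v: "card (N v) = Max ((\<lambda>x. card (N x)) ` R)" by auto
  have vmax: "card (N x) \<le> card (N v)" if "x \<in> R" for x using fin that unfolding v by simp
  \<comment> \<open>Sending an edge at \<open>x\<close> to its other end is injective, since
    \<open>anti\<close> forbids opposite edges.\<close>
  have S_le: "card (S x) \<le> card (N x)" for x
  proof (rule card_inj_on_le[where f = "\<lambda>e. if fst e = x then snd e else fst e"])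
    show "inj_on (\<lambda>e. if fst e = x then snd e else fst e) (S x)"
      using anti by (auto simp: inj_on_def S_def split: if_splits)
    show "(\<lambda>e. if fst e = x then snd e else fst e) ` S x \<subseteq> N x"
      by (auto simp: S_def N_def)
  qed (rule finN)
  have "H \<subseteq> (\<Union>x\<in>R - N v. S x)"
  proof
    fix e assume e: "e \<in> H"
    obtain a b where ab: "e = (a, b)" by fastforce
    have "a \<notin> N v \<or> b \<notin> N v" using tri[of a v b] e ab by (auto simp: N_def)
    then show "e \<in> (\<Union>x\<in>R - N v. S x)" using e ab sub by (auto simp: S_def)
  qed
  moreover have "finite H" using sub fin by (meson finite_SigmaI finite_subset)
  then have "finite (\<Union>x\<in>R - N v. S x)" by (rule rev_finite_subset) (auto simp: S_def)
  ultimately have "card H \<le> card (\<Union>x\<in>R - N v. S x)" by (rule card_mono[rotated])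
  also have "\<dots> \<le> (\<Sum>x\<in>R - N v. card (S x))" using fin by (intro card_UN_le) simp
  also have "\<dots> \<le> (\<Sum>x\<in>R - N v. card (N v))"
    by (rule sum_mono) (meson DiffD1 S_le le_trans vmax)
  also have "\<dots> = (card R - card (N v)) * card (N v)"
    using card_Diff_subset[OF finN NR] by simp
  finally have le: "card H \<le> (card R - card (N v)) * card (N v)" .
  obtain c where c: "card R = card (N v) + c"
    using card_mono[OF fin NR[of v]] le_Suc_ex by blast
  \<comment> \<open>AM-GM, from the square of \<open>d - c\<close> being nonnegative.\<close>
  have "4 * (c * d) \<le> (d + c)\<^sup>2" for d :: nat
  proof -
    have "0 \<le> (int d)\<^sup>2 + (int c)\<^sup>2 - 2 * int d * int c"
      using zero_le_power2[of "int d - int c"] by (simp only: power2_diff)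
    then have "int (4 * (c * d)) \<le> int ((d + c)\<^sup>2)" by (simp add: power2_eq_square algebra_simps)
    then show ?thesis by linarith
  qed
  then show ?thesis using le c by (metis diff_add_inverse le_trans mult_le_mono2)
qed

section \<open>Spanning forests and contraction of strong components\<close>

text \<open>Each non-root takes as parent its predecessor on a shortest path from its root.
  \<open>pred\<close> keeps the parent in \<open>V\<close> with the same root, so distances drop
  along parents and induction reaches the root. One arc is spent per non-root.\<close>

lemma spanning_forest:
  assumes fin: "finite V"
    and root: "\<And>v. v \<in> V \<Longrightarrow> (r v, v) \<in> E\<^sup>*"
    and pred: "\<And>v p. v \<in> V \<Longrightarrow> (r v, p) \<in> E\<^sup>* \<Longrightarrow> (p, v) \<in> E \<Longrightarrow> p \<in> V \<and> r p = r v"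
  obtains F where "F \<subseteq> E" "card F \<le> card {v \<in> V. r v \<noteq> v}"
    "\<And>v. v \<in> V \<Longrightarrow> (r v, v) \<in> F\<^sup>*"
proof -
  define d where "d v = (LEAST k. (r v, v) \<in> E ^^ k)" for v
  define W where "W = {v \<in> V. r v \<noteq> v}"
  have "\<exists>p. (p, v) \<in> E \<and> p \<in> V \<and> r p = r v \<and> d p < d v" if "v \<in> W" for v
  proof -
    have v: "v \<in> V" "r v \<noteq> v" using that by (auto simp: W_def)
    have "(r v, v) \<in> E ^^ d v"
      using rtrancl_imp_relpow[OF root[OF v(1)]] unfolding d_def by (auto intro: LeastI_ex)
    moreover from this v(2) obtain k where k: "d v = Suc k" by (cases "d v") auto
    ultimately obtain p where p: "(r v, p) \<in> E ^^ k" "(p, v) \<in> E" by auto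
    have pv: "p \<in> V \<and> r p = r v" using pred[OF v(1) relpow_imp_rtrancl[OF p(1)] p(2)] .
    then have "d p \<le> k" unfolding d_def using p(1) by (intro Least_le) simp
    then show ?thesis using p pv k by auto
  qed
  then obtain p where p: "\<And>v. v \<in> W \<Longrightarrow> (p v, v) \<in> E \<and> p v \<in> V \<and> r (p v) = r v \<and> d (p v) < d v"
    by metis
  define F where "F = (\<lambda>v. (p v, v)) ` W"
  have finW: "finite W" using fin by (simp add: W_def)
  have reach: "(r v, v) \<in> F\<^sup>*" if "v \<in> V" for v
    using that
  proof (induction "d v" arbitrary: v rule: less_induct)
    case less
    show ?case
    proof (cases "v \<in> W")
      case True
      then have "(r (p v), p v) \<in> F\<^sup>*" using less p by blast
      moreover have "(p v, v) \<in> F" using True by (simp add: F_def)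
      ultimately show ?thesis using p[OF True] by (metis rtrancl.rtrancl_into_rtrancl)
    next
      case False
      then show ?thesis using less.prems by (simp add: W_def)
    qed
  qed
  show thesis
  proof (rule that[of F])
    show "card F \<le> card {v \<in> V. r v \<noteq> v}"
      unfolding F_def W_def[symmetric] by (rule card_image_le[OF finW])
  qed (use p reach finW in \<open>auto simp: F_def\<close>)
qed

text \<open>The witness for \<open>m\<close> is the number of strong components, counted by their
  roots.\<close>

lemma card_irredundant_le:
  assumes fin: "finite V" and sub: "E \<subseteq> V \<times> V"
    and irr: "\<And>u v. (u, v) \<in> E \<Longrightarrow> (u, v) \<notin> (E - {(u, v)})\<^sup>*"
  obtains m where "m \<le> card V" "V \<noteq> {} \<Longrightarrow> 1 \<le> m" "4 * card E \<le> 8 * (card V - m) + m\<^sup>2"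
proof -
  define C where "C v = {x. (x, v) \<in> E\<^sup>* \<and> (v, x) \<in> E\<^sup>*}" for v
  \<comment> \<open>The choice depends only on the set \<open>C v\<close>, so all members of a
    component share one root.\<close>
  define r where "r v = (SOME x. x \<in> C v)" for v
  have rC: "r v \<in> C v" for v
    unfolding r_def by (rule someI[of _ v]) (simp add: C_def)
  then have r_to: "(r v, v) \<in> E\<^sup>*" and r_from: "(v, r v) \<in> E\<^sup>*" for v by (auto simp: C_def)
  have r_eq: "r x = r y" if "(x, y) \<in> E\<^sup>*" "(y, x) \<in> E\<^sup>*" for x y
  proof -
    have "C x = C y" using that unfolding C_def by (blast intro: rtrancl_trans)
    then show ?thesis by (simp add: r_def)
  qed
  have idem: "r (r v) = r v" for v using r_eq r_to r_from by blast
  have pred: "p \<in> V \<and> r p = r v" if "(r v, p) \<in> E\<^sup>*" "(p, v) \<in> E" for v p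
  proof
    show "r p = r v" using that r_from by (intro r_eq) (blast intro: rtrancl_trans)+
    show "p \<in> V" using that sub by auto
  qed
  \<comment> \<open>Mirror image of \<open>pred\<close>: it lets the forest lemma on
    \<open>E\<inverse>\<close> yield in-trees.\<close>
  have succ: "p \<in> V \<and> r p = r v" if "(r v, p) \<in> (E\<inverse>)\<^sup>*" "(p, v) \<in> E\<inverse>" for v p
  proof
    have "(p, r v) \<in> E\<^sup>*" "(v, p) \<in> E" using that by (simp_all add: rtrancl_converse)
    then show "r p = r v" using r_to by (intro r_eq) (blast intro: rtrancl_trans)+
    show "p \<in> V" using that sub by auto
  qed
  have r_from': "(r v, v) \<in> (E\<inverse>)\<^sup>*" for v using r_from by (simp add: rtrancl_converse)
  obtain F where F: "F \<subseteq> E" "card F \<le> card {v \<in> V. r v \<noteq> v}"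
    "\<And>v. v \<in> V \<Longrightarrow> (r v, v) \<in> F\<^sup>*"
    using spanning_forest[OF fin r_to pred] by blast
  obtain G where G: "G \<subseteq> E\<inverse>" "card G \<le> card {v \<in> V. r v \<noteq> v}"
    "\<And>v. v \<in> V \<Longrightarrow> (r v, v) \<in> G\<^sup>*"
    using spanning_forest[OF fin r_from' succ] by blast
  define T where "T = F \<union> G\<inverse>"
  have TE: "T \<subseteq> E" using F(1) G(1) by (auto simp: T_def)
  have conn: "(x, y) \<in> T\<^sup>*" if "x \<in> V" "y \<in> V" "r x = r y" for x y
  proof -
    have "(x, r x) \<in> (G\<inverse>)\<^sup>*" "(r y, y) \<in> F\<^sup>*"
      using F(3)[OF that(2)] G(3)[OF that(1)] by (simp_all add: rtrancl_converse)
    then have "(x, r x) \<in> T\<^sup>*" "(r y, y) \<in> T\<^sup>*"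
      unfolding T_def by (meson in_rtrancl_UnI)+
    then show ?thesis using that(3) by simp
  qed
  \<comment> \<open>\<open>T\<close>-paths avoid any arc outside \<open>T\<close>; every bypass
    below is assembled from such paths.\<close>
  have T_avoid: "T\<^sup>* \<subseteq> (E - {(u, v)})\<^sup>*" if "(u, v) \<notin> T" for u v
    using TE that by (intro rtrancl_mono) auto
  have T_all: "(u, v) \<in> T" if "(u, v) \<in> E" "r u = r v" for u v
    using irr[OF that(1)] conn[of u v] that sub T_avoid by blast

  \<comment> \<open>\<open>X\<close> holds only arcs between different components, as
    \<open>T\<close> contains all inner ones; \<open>q\<close> contracts an arc to the roots of its
    ends.\<close>
  define X where "X = E - T"
  define R where "R = {v \<in> V. r v = v}"
  define q where "q = map_prod r r"
  define H where "H = q ` X"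
  have XE: "(u, v) \<in> E" "u \<in> V" "v \<in> V" "(u, v) \<notin> T" "r u \<noteq> r v" if "(u, v) \<in> X" for u v
    using that sub T_all by (auto simp: X_def)
  have rV: "r v \<in> V" if "v \<in> V" for v
    using r_to[of v] that sub by (cases rule: converse_rtranclE) auto
  \<comment> \<open>If \<open>e\<close> and \<open>e'\<close> lead from one component to the same
    other one, \<open>e\<close> is bypassed: go from \<open>u\<close> to \<open>u'\<close> in
    \<open>T\<close>, along \<open>e'\<close>, then from \<open>v'\<close> to \<open>v\<close> in
    \<open>T\<close>.\<close>
  have inj: "inj_on q X"
  proof (rule inj_onI, rule ccontr)
    fix e e' assume e: "e \<in> X" "e' \<in> X" "q e = q e'" "e \<noteq> e'"
    obtain u v u' v' where uv: "e = (u, v)" "e' = (u', v')" by fastforce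
    note X = XE[OF e(1)[unfolded uv]] XE[OF e(2)[unfolded uv]]
    have "(u, u') \<in> T\<^sup>*" "(v', v) \<in> T\<^sup>*"
      using e(3) X by (auto intro!: conn simp: uv q_def)
    then have "(u, u') \<in> (E - {(u, v)})\<^sup>*" "(v', v) \<in> (E - {(u, v)})\<^sup>*"
      using T_avoid[OF X(4)] by auto
    moreover have "(u', v') \<in> E - {(u, v)}" using X e(4) uv by auto
    ultimately have "(u, v) \<in> (E - {(u, v)})\<^sup>*" by (meson rtrancl.rtrancl_into_rtrancl rtrancl_trans)
    then show False using irr X(1) by blast
  qed
  have HE: "(a, b) \<in> E\<^sup>*" if "(a, b) \<in> H" for a b
    using that r_to r_from unfolding H_def q_def X_def
    by clarsimp (meson r_into_rtrancl rtrancl_trans)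
  have Hr: "r a = a" "r b = b" "a \<noteq> b" if "(a, b) \<in> H" for a b
    using that idem XE(5) by (auto simp: H_def q_def)
  have anti: "(b, a) \<notin> E\<^sup>*" if "(a, b) \<in> H" for a b
    using r_eq[OF HE[OF that]] Hr[OF that] by metis
  \<comment> \<open>Arcs lying over \<open>(a, b)\<close> and \<open>(b, c)\<close>, linked by
    \<open>T\<close>-paths within the three components, bypass any arc lying over
    \<open>(a, c)\<close>.\<close>
  have trans: "(a, c) \<notin> H" if ab: "(a, b) \<in> H" and bc: "(b, c) \<in> H" for a b c
  proof
    assume "(a, c) \<in> H"
    then obtain x z where xz: "(x, z) \<in> X" "r x = a" "r z = c" by (auto simp: H_def q_def)
    obtain x1 y1 where 1: "(x1, y1) \<in> X" "r x1 = a" "r y1 = b" using ab by (auto simp: H_def q_def)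
    obtain y2 z2 where 2: "(y2, z2) \<in> X" "r y2 = b" "r z2 = c" using bc by (auto simp: H_def q_def)
    let ?E = "E - {(x, z)}"
    have "(x, x1) \<in> T\<^sup>*" "(y1, y2) \<in> T\<^sup>*" "(z2, z) \<in> T\<^sup>*"
      using xz 1 2 XE by (auto intro!: conn)
    then have "(x, x1) \<in> ?E\<^sup>*" "(y1, y2) \<in> ?E\<^sup>*" "(z2, z) \<in> ?E\<^sup>*"
      using T_avoid[OF XE(4)[OF xz(1)]] by auto
    \<comment> \<open>Equality with \<open>(x, z)\<close> would force \<open>b = c\<close> or
      \<open>b = a\<close>.\<close>
    moreover have "(x1, y1) \<in> ?E" "(y2, z2) \<in> ?E"
      using XE(1)[OF 1(1)] XE(1)[OF 2(1)] 1 2 xz Hr(3)[OF ab] Hr(3)[OF bc] by auto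
    ultimately have "(x, z) \<in> ?E\<^sup>*" by (meson rtrancl.rtrancl_into_rtrancl rtrancl_trans)
    then show False using irr XE(1) xz(1) by blast
  qed
  have mantel: "4 * card H \<le> (card R)\<^sup>2"
  proof (rule mantel_antisym)
    show "finite R" using fin by (simp add: R_def)
    show "H \<subseteq> R \<times> R"
      using XE rV idem by (auto simp: H_def q_def R_def)
    show "(b, a) \<notin> H" if "(a, b) \<in> H" for a b using anti[OF that] HE by blast
    \<comment> \<open>A triangle in the underlying undirected graph is either transitive, excluded
      by \<open>trans\<close>, or cyclic, which would merge components.\<close>
    have cyc: False if "(a, b) \<in> H" "(b, c) \<in> H" "(c, a) \<in> H" for a b c
      using anti[OF that(1)] HE[OF that(2)] HE[OF that(3)] by (meson rtrancl_trans)
    show "(a, c) \<notin> H \<union> H\<inverse>" if "(a, b) \<in> H \<union> H\<inverse>" "(b, c) \<in> H \<union> H\<inverse>" for a b c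
      using that trans cyc by blast
  qed

  have "card E = card T + card X"
    unfolding X_def using TE fin sub
    by (metis Diff_disjoint Un_Diff_cancel card_Un_disjoint finite_Diff finite_SigmaI finite_subset
        le_iff_sup sup.absorb2)
  also have "card X = card H" unfolding H_def by (rule card_image[OF inj, symmetric])
  also have "card T \<le> card F + card G" unfolding T_def
    by (metis card_Un_le card_inverse)
  finally have "card E \<le> 2 * card {v \<in> V. r v \<noteq> v} + card H" using F(2) G(2) by linarith
  moreover have "{v \<in> V. r v \<noteq> v} = V - R" by (auto simp: R_def)
  moreover have RV: "R \<subseteq> V" by (auto simp: R_def)
  ultimately have "card E \<le> 2 * (card V - card R) + card H"
    using fin by (simp add: card_Diff_subset finite_subset)
  then have main: "4 * card E \<le> 8 * (card V - card R) + (card R)\<^sup>2" using mantel by linarith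
  show thesis
  proof (rule that[OF _ _ main])
    show "card R \<le> card V" by (rule card_mono[OF fin RV])
    assume "V \<noteq> {}"
    then obtain v where "v \<in> V" by blast
    then have "r v \<in> R" using rV idem by (simp add: R_def)
    then show "1 \<le> card R" using fin RV by (metis One_nat_def Suc_leI card_gt_0_iff empty_iff finite_subset)
  qed
qed

section \<open>Bypassing paths as transitive cycles\<close>

text \<open>A shortest path repeats no vertex: cutting out the loop between equal vertices at
  \<open>i < j\<close> would leave only \<open>i + (n - j)\<close> steps.\<close>

lemma rtrancl_simple_path:
  assumes "(u, v) \<in> S\<^sup>*"
  obtains n f where "f 0 = u" "f n = v" "\<And>i. i < n \<Longrightarrow> (f i, f (Suc i)) \<in> S" "inj_on f {..n}"
proof -
  define n where "n = (LEAST n. (u, v) \<in> S ^^ n)"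
  have "(u, v) \<in> S ^^ n"
    using rtrancl_imp_relpow[OF assms] unfolding n_def by (auto intro: LeastI_ex)
  then obtain f where f: "f 0 = u" "f n = v" "\<And>i. i < n \<Longrightarrow> (f i, f (Suc i)) \<in> S"
    unfolding relpow_fun_conv by blast
  have "f i \<noteq> f j" if "i < j" "j \<le> n" for i j
  proof
    assume eq: "f i = f j"
    have "(u, f i) \<in> S ^^ i"
      unfolding relpow_fun_conv using f that by (intro exI[of _ f]) auto
    moreover have "(f j, v) \<in> S ^^ (n - j)"
      unfolding relpow_fun_conv using f that by (intro exI[of _ "\<lambda>l. f (j + l)"]) auto
    ultimately have "(u, v) \<in> S ^^ (i + (n - j))" unfolding relpow_add eq by blast
    then have "n \<le> i + (n - j)" unfolding n_def by (rule Least_le)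
    then show False using that by linarith
  qed
  then have "inj_on f {..n}" by (metis atMost_iff inj_onI nat_neq_iff)
  then show thesis using that f by blast
qed

text \<open>A simple path of \<open>n\<close> arcs from \<open>u\<close> to \<open>v\<close>
  avoiding \<open>(u, v)\<close>, closed off by that arc, is a transitive cycle on
  \<open>n + 1\<close> vertices.\<close>

lemma TC_free_arc_irredundant:
  assumes D: "digraph D" and free: "\<And>k. k \<ge> 3 \<Longrightarrow> TC_free k D"
    and uv: "(u, v) \<in> arcs_ends D"
  shows "(u, v) \<notin> (arcs_ends D - {(u, v)})\<^sup>*"
proof
  interpret digraph D by (rule D)
  assume "(u, v) \<in> (arcs_ends D - {(u, v)})\<^sup>*"
  then obtain n f where f: "f 0 = u" "f n = v"
      "\<And>i. i < n \<Longrightarrow> (f i, f (Suc i)) \<in> arcs_ends D - {(u, v)}" "inj_on f {..n}"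
    by (rule rtrancl_simple_path) blast
  have "u \<noteq> v" using uv adj_not_same by blast
  then have "n \<noteq> 0" using f by (intro notI) simp
  \<comment> \<open>A single step would be the deleted arc itself.\<close>
  moreover have "n \<noteq> 1" using f(1,2) f(3)[of 0] by auto
  ultimately have n: "n \<ge> 2" by linarith
  let ?w = "\<lambda>i. f (i - 1)"
  have step: "(?w i, ?w (i + 1)) \<in> arcs_ends D" if "i \<in> {1..n}" for i
    using f(3)[of "i - 1"] that by auto
  have "inj_on ?w {1..n + 1}"
  proof (rule inj_onI)
    fix i j assume ij: "i \<in> {1..n + 1}" "j \<in> {1..n + 1}" "?w i = ?w j"
    have "i - 1 = j - 1" using ij by (intro inj_onD[OF f(4) ij(3)]) auto
    then show "i = j" using ij by auto
  qed
  moreover have "?w i \<in> verts D" if "i \<in> {1..n + 1}" for i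
  proof (cases "i = n + 1")
    case True
    then show ?thesis using f(2) uv adj_in_verts(2) by auto
  next
    case False
    then show ?thesis using step[of i] that adj_in_verts(1) by auto
  qed
  then have "?w ` {1..n + 1} \<subseteq> verts D" by blast
  moreover have "(?w 1, ?w (n + 1)) \<in> arcs_ends D" using f uv by simp
  moreover have "\<forall>i\<in>{1..n + 1 - 1}. (?w i, ?w (i + 1)) \<in> arcs_ends D" using step by simp
  moreover have "TC_free (n + 1) D" "n + 1 \<ge> 3" using free n by simp_all
  ultimately show False using TC_free_iff[OF wf_digraph_axioms, of "n + 1"] by blast
qed

section \<open>Optimisation over the number of components\<close>

text \<open>The bound is convex in \<open>m\<close>, hence largest at \<open>m = 1\<close> or
  \<open>m = n\<close>, where it is \<open>8 * n - 7\<close> or the square of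
  \<open>n\<close>.\<close>

lemma max_endpoints:
  fixes c m n :: nat
  assumes m: "1 \<le> m" "m \<le> n" and c: "4 * c \<le> 8 * (n - m) + m\<^sup>2"
  shows "int c \<le> max (2 * (int n - 1)) \<lfloor>(real n)\<^sup>2 / 4\<rfloor>"
\<comment> \<open>The bound takes equal values at \<open>m = 1\<close> and \<open>m = 7\<close>, so
  \<open>m = 1\<close> dominates up to 7 and \<open>m = n\<close> beyond.\<close>
proof (cases "m \<le> 7")
  case True
  have "int (4 * c) \<le> int (8 * (n - m) + m\<^sup>2)" using c by linarith
  then have "4 * int c \<le> 8 * int n - 8 * int m + (int m)\<^sup>2" using m by (simp add: of_nat_diff)
  \<comment> \<open>This gives \<open>4 * c \<le> 8 * n - 7\<close>, and integrality of
    \<open>c\<close> sharpens it to \<open>c \<le> 2 * (n - 1)\<close>.\<close>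
  moreover have "(int m - 1) * (int m - 7) \<le> 0" using True m by (intro mult_nonneg_nonpos) auto
  ultimately show ?thesis by (simp add: power2_eq_square algebra_simps)
next
  case False
  have "0 \<le> (int n - int m) * (int n + int m - 8)" using False m by (intro mult_nonneg_nonneg) auto
  moreover have "int (4 * c) \<le> int (8 * (n - m) + m\<^sup>2)" using c by linarith
  then have "4 * int c \<le> 8 * int n - 8 * int m + (int m)\<^sup>2" using m by (simp add: of_nat_diff)
  ultimately have "4 * int c \<le> (int n)\<^sup>2" by (simp add: power2_eq_square algebra_simps)
  then have "real_of_int (4 * int c) \<le> real_of_int ((int n)\<^sup>2)" by (simp only: of_int_le_iff)
  then have "int c \<le> \<lfloor>(real n)\<^sup>2 / 4\<rfloor>" by (simp add: le_floor_iff)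
  then show ?thesis by simp
qed

theorem theorem1p7:
  fixes D :: "('a, 'b) pre_digraph" and n :: nat
  assumes "n \<ge> 1"
    and "digraph D"
    and "card (verts D) = n"
    and "\<And>k. k \<ge> 3 \<Longrightarrow> TC_free k D"
  shows "int (card (arcs D)) \<le> max (2 * (int n - 1)) \<lfloor>(real n)\<^sup>2 / 4\<rfloor>"
proof -
  interpret digraph D by (rule assms)
  \<comment> \<open>Without parallel arcs, counting arcs amounts to counting ordered pairs.\<close>
  have "inj_on (arc_to_ends D) (arcs D)"
    using no_multi_arcs by (auto intro: inj_onI)
  then have card: "card (arcs D) = card (arcs_ends D)"
    unfolding arcs_ends_def by (simp add: card_image)
  have sub: "arcs_ends D \<subseteq> verts D \<times> verts D"
    by (auto simp: adj_in_verts)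
  obtain m where "m \<le> card (verts D)" "verts D \<noteq> {} \<Longrightarrow> 1 \<le> m"
    "4 * card (arcs_ends D) \<le> 8 * (card (verts D) - m) + m\<^sup>2"
    using card_irredundant_le[OF finite_verts sub TC_free_arc_irredundant[OF assms(2,4)]] by blast
  moreover have "verts D \<noteq> {}" using assms(1,3) by auto
  ultimately show ?thesis using max_endpoints assms(3) card by metis
qed

end
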